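(* For all integers $k\ge0$ and all $1\le p<\infty$ we have $C_{k,p}\ge\frac12$. This lower bound is witnessed by the sequence $(\chi_{S_m})_{m\in\mathbb{N}}$ with $S_m:=\{0,3,6,\dots,3(m-1)\}$, i.e. $$\liminf_{m\to\infty}\frac{\|(\mathcal{M}\chi_{S_m})^{(k)}\|_{\ell^p(\mathbb{Z})}}{\|\chi_{S_m}^{(k)}\|_{\ell^p(\mathbb{Z})}}\ge\frac12.$$
   Context: An interval in $\mathbb{Z}$ is a nonempty finite set of consecutive integers. For $f:\mathbb{Z}\to\mathbb{R}$ the discrete uncentered maximal function is $\mathcal{M}f(n)=\sup_{I\ni n}\frac1{|I|}\sum_{i\in I}|f(i)|$, the supremum being over all intervals $I\subset\mathbb{Z}$ containing $n$, with $|I|$ the cardinality of $I$. Discrete derivatives: $f^{(0)}=f$ and $f^{(k+1)}(n)=f^{(k)}(n+1)-f^{(k)}(n)$. For $S\subseteq\mathbb{Z}$, $\chi_S$ is its characteristic function. For $k\ge0$ and $1\le p\le\infty$, $C_{k,p}\in[0,\infty]$ is the smallest number such that $\|(\mathcal{M}\chi_S)^{(k)}\|_{\ell^p(\mathbb{Z})}\le C_{k,p}\|\chi_S^{(k)}\|_{\ell^p(\mathbb{Z})}$ for all $S\subseteq\mathbb{Z}$ with $\|\chi_S^{(k)}\|_{\ell^p(\mathbb{Z})}<\infty$. Norms may take the value $+\infty$ (for $k=0$, $p=1$ the numerator of the ratio is $+\infty$). *)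

theory Defs
  imports "HOL-Analysis.Analysis"
begin

definition int_interval :: "int set \<Rightarrow> bool" where
  "int_interval I \<longleftrightarrow> (\<exists>a b. a \<le> b \<and> I = {a..b})"

(* The supremum is taken in the reals, so the value is meaningful only where the averages are
   bounded; this holds for characteristic functions, whose averages lie in [0,1]. *)
definition maximal_fun :: "(int \<Rightarrow> real) \<Rightarrow> int \<Rightarrow> real" where
  "maximal_fun f n = (SUP I\<in>{I. int_interval I \<and> n \<in> I}. (\<Sum>i\<in>I. \<bar>f i\<bar>) / real (card I))"

primrec discrete_deriv :: "nat \<Rightarrow> (int \<Rightarrow> real) \<Rightarrow> int \<Rightarrow> real" where
  "discrete_deriv 0 f = f"
| "discrete_deriv (Suc k) f = (\<lambda>n. discrete_deriv k f (n + 1) - discrete_deriv k f n)"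

(* Meant for 1 <= p <= \<infinity>. *)
definition lp_norm :: "ennreal \<Rightarrow> (int \<Rightarrow> real) \<Rightarrow> ennreal" where
  "lp_norm p f =
    (if p = \<infinity> then (SUP n. ennreal \<bar>f n\<bar>)
     else if (\<lambda>n. \<bar>f n\<bar> powr enn2real p) summable_on UNIV
     then ennreal ((\<Sum>\<^sub>\<infinity>n. \<bar>f n\<bar> powr enn2real p) powr (1 / enn2real p))
     else \<infinity>)"

(* The constant C_{k,p}. The infimum is a minimum: the condition is closed in C because the
   norms on the right are finite, and C = \<infinity> satisfies it. For the latter note that
   \<infinity> * 0 = 0 in ennreal, and that a vanishing right-hand norm forces the characteristic
   function, hence also its maximal function, to be constant (and zero if k = 0). *)
definition best_const :: "nat \<Rightarrow> ennreal \<Rightarrow> ennreal" where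
  "best_const k p = Inf {C. \<forall>S :: int set.
     lp_norm p (discrete_deriv k (indicator S)) < \<infinity> \<longrightarrow>
     lp_norm p (discrete_deriv k (maximal_fun (indicator S)))
       \<le> C * lp_norm p (discrete_deriv k (indicator S))}"

definition witness_set :: "nat \<Rightarrow> int set" where
  "witness_set m = (\<lambda>j. 3 * int j) ` {..<m}"

end

theory Submission
  imports Defs
begin

text \<open>
  Let \<open>u\<close> be the characteristic function of \<open>3\<int>\<close>. An interval of length at least 2 has at most half
  of its points in \<open>3\<int>\<close>, so on \<open>{-1..3m-2}\<close> the maximal function of \<open>\<chi>\<close> of the witness set is
  \<open>1/2 + u/2\<close>. Hence, up to boundedly many points near the two ends, the \<open>k\<close>-th derivative of the
  maximal function is (for \<open>k = 0\<close>: at least) half of that of the characteristic function itself.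
  The latter is periodic and not identically zero on the bulk, whose contribution to the norm
  therefore tends to infinity with \<open>m\<close>, and the ends become negligible.
\<close>

section \<open>Discrete derivatives: locality, affine images, periodicity, size\<close>

lemma discrete_deriv_cong:
  assumes "\<And>i. n \<le> i \<Longrightarrow> i \<le> n + int k \<Longrightarrow> f i = g i"
  shows "discrete_deriv k f n = discrete_deriv k g n"
  using assms
proof (induction k arbitrary: n)
  case (Suc k)
  have "discrete_deriv k f n = discrete_deriv k g n"
    by (rule Suc.IH) (use Suc.prems in auto)
  moreover have "discrete_deriv k f (n + 1) = discrete_deriv k g (n + 1)"
    by (rule Suc.IH) (use Suc.prems in auto)
  ultimately show ?case by simp
qed simp

text \<open>Taking a difference removes constants. For the maximal function this means that the
  summand 1/2 survives only in order 0.\<close>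

lemma discrete_deriv_affine:
  "discrete_deriv k (\<lambda>i. a + c * f i) n = (if k = 0 then a else 0) + c * discrete_deriv k f n"
  by (induction k arbitrary: n) (auto simp: algebra_simps)

lemma discrete_deriv_periodic:
  assumes "\<And>n. f (n + d) = f n"
  shows "discrete_deriv k f (n + d) = discrete_deriv k f n"
proof (induction k arbitrary: n)
  case (Suc k)
  have "discrete_deriv k f (n + d + 1) = discrete_deriv k f (n + 1)"
    using Suc[of "n + 1"] by (simp add: ac_simps)
  then show ?case using Suc[of n] by simp
qed (simp add: assms)

lemma abs_discrete_deriv_le:
  assumes "\<And>n. \<bar>f n\<bar> \<le> B"
  shows "\<bar>discrete_deriv k f n\<bar> \<le> 2 ^ k * B"
proof (induction k arbitrary: n)
  case (Suc k)
  show ?case using Suc[of n] Suc[of "n + 1"] by simp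
qed (simp add: assms)

lemma add_period_mult:
  fixes f :: "int \<Rightarrow> 'a"
  assumes "\<And>n. f (n + d) = f n"
  shows "f (n + int j * d) = f n"
proof (induction j)
  case (Suc j)
  then show ?case using assms[of "n + int j * d"] by (simp add: algebra_simps)
qed simp

section \<open>Norms and finite sums\<close>

lemma one_le_enn2real:
  assumes "1 \<le> p" "p < \<infinity>"
  shows "1 \<le> enn2real p"
  using enn2real_mono[of 1 p] assms by simp

text \<open>Without summability the norm is infinite and the bound is trivial. This case does occur:
  a maximal function decaying like 1/|n| is not in l^1.\<close>

lemma lp_norm_ge_finite:
  assumes "p < \<infinity>" "1 \<le> p" "finite F"
  shows "ennreal ((\<Sum>n\<in>F. \<bar>f n\<bar> powr enn2real p) powr (1 / enn2real p)) \<le> lp_norm p f"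
proof (cases "(\<lambda>n. \<bar>f n\<bar> powr enn2real p) summable_on UNIV")
  case True
  have "(\<Sum>n\<in>F. \<bar>f n\<bar> powr enn2real p) \<le> (\<Sum>\<^sub>\<infinity>n. \<bar>f n\<bar> powr enn2real p)"
    by (rule finite_sum_le_infsum[OF True]) (use assms in auto)
  then show ?thesis
    using True assms by (auto simp: lp_norm_def intro!: ennreal_leI powr_mono2 sum_nonneg)
qed (use assms in \<open>auto simp: lp_norm_def\<close>)

lemma lp_norm_eq_finite:
  assumes "p < \<infinity>" "finite F" "\<And>n. n \<notin> F \<Longrightarrow> f n = 0"
  shows "lp_norm p f = ennreal ((\<Sum>n\<in>F. \<bar>f n\<bar> powr enn2real p) powr (1 / enn2real p))"
proof -
  have "((\<lambda>n. \<bar>f n\<bar> powr enn2real p) has_sum (\<Sum>n\<in>F. \<bar>f n\<bar> powr enn2real p)) UNIV"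
    by (rule has_sum_finite_neutralI[OF assms(2)]) (use assms in auto)
  then show ?thesis
    using assms(1) by (auto simp: lp_norm_def has_sum_imp_summable infsumI)
qed

section \<open>The periodic model\<close>

abbreviation chi3 :: "int \<Rightarrow> real" where
  "chi3 \<equiv> indicator {n. 3 dvd n}"

lemma chi3_periodic: "chi3 (n + 3) = chi3 n"
  by (auto simp: indicator_def)

text \<open>If order \<open>k + 1\<close> vanished, order \<open>k\<close> would be constant. For
  \<open>k > 0\<close> it consists of differences of a function of period 3, so three consecutive
  values sum to 0 and the constant is 0, against the induction hypothesis.\<close>

lemma discrete_deriv_chi3_nonzero: "\<exists>n. discrete_deriv k chi3 n \<noteq> 0"
proof (induction k)
  case 0
  show ?case by (auto intro!: exI[of _ 0])
next
  case (Suc k)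
  show ?case
  proof (rule ccontr)
    assume "\<not> ?thesis"
    then have step: "discrete_deriv k chi3 (n + 1) = discrete_deriv k chi3 n" for n
      by simp
    show False
    proof (cases k)
      case 0
      then show False using step[of 0] by simp
    next
      case (Suc l)
      have "discrete_deriv l chi3 (n + 3) = discrete_deriv l chi3 n" for n
        by (rule discrete_deriv_periodic) (rule chi3_periodic)
      then have "discrete_deriv k chi3 n = 0" for n
        using step[of n] step[of "n + 1"] by (simp add: Suc add.assoc)
      then show False using \<open>\<exists>n. discrete_deriv k chi3 n \<noteq> 0\<close> by simp
    qed
  qed
qed

section \<open>The witness set and its maximal function\<close>

lemma witness_set_iff:
  "n \<in> witness_set m \<longleftrightarrow> 3 dvd n \<and> 0 \<le> n \<and> n \<le> 3 * int m - 3"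
proof
  assume "3 dvd n \<and> 0 \<le> n \<and> n \<le> 3 * int m - 3"
  then have "n = 3 * int (nat (n div 3))" "nat (n div 3) < m" by auto
  then show "n \<in> witness_set m" unfolding witness_set_def by blast
qed (auto simp: witness_set_def)

text \<open>The range is as wide as possible: the next multiples of 3 beyond it are -3 and
  \<open>3 * int m\<close>, neither of which lies in the set.\<close>

lemma witness_set_iff_dvd:
  assumes "-2 \<le> n" "n \<le> 3 * int m - 1"
  shows "n \<in> witness_set m \<longleftrightarrow> 3 dvd n"
  using assms unfolding witness_set_iff by presburger

text \<open>The multiples are 3t with t between the ceiling of a/3, which is
  \<open>(a + 2) div 3\<close>, and the floor of b/3.\<close>

lemma card_multiples_of_3:
  "card {i \<in> {a..b}. 3 dvd i} = nat (b div 3 - (a + 2) div 3 + 1)" for a b :: int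
proof -
  have "{i \<in> {a..b}. 3 dvd i} = (*) 3 ` {(a + 2) div 3..b div 3}"
    by (auto elim!: dvdE intro!: imageI)
  then show ?thesis by (simp add: card_image inj_on_def)
qed

lemma average_indicator:
  fixes I :: "int set"
  assumes "finite I"
  shows "(\<Sum>i\<in>I. \<bar>indicator S i :: real\<bar>) / real (card I) = real (card (S \<inter> I)) / real (card I)"
  using assms by (simp add: sum.If_cases indicator_def Int_commute)

text \<open>A supremum of reals dominates its members only if the family is bounded above; here all
  averages are at most 1.\<close>

lemma average_indicator_le_maximal_fun:
  assumes "n \<in> {a..b}"
  shows "real (card (S \<inter> {a..b})) / real (card {a..b}) \<le> maximal_fun (indicator S) n"
proof -
  let ?avg = "\<lambda>I. (\<Sum>i\<in>I. \<bar>indicator S i :: real\<bar>) / real (card I)"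
  have "?avg I \<le> 1" if "int_interval I" for I
  proof -
    have "finite I" using that by (auto simp: int_interval_def)
    then show ?thesis
      by (subst average_indicator) (auto simp: divide_le_eq_1 card_mono)
  qed
  then have "bdd_above (?avg ` {I. int_interval I \<and> n \<in> I})"
    by (intro bdd_aboveI2[where M = 1]) auto
  moreover have "{a..b} \<in> {I. int_interval I \<and> n \<in> I}"
    using assms by (auto simp: int_interval_def)
  ultimately have "?avg {a..b} \<le> maximal_fun (indicator S) n"
    unfolding maximal_fun_def by (rule cSUP_upper2) simp
  then show ?thesis by (simp only: average_indicator finite_atLeastAtMost_int)
qed

lemma maximal_fun_indicator_le:
  assumes "\<And>a b. n \<in> {a..b} \<Longrightarrow> real (card (S \<inter> {a..b})) / real (card {a..b}) \<le> B"
  shows "maximal_fun (indicator S) n \<le> B"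
  unfolding maximal_fun_def
proof (rule cSUP_least)
  have "{n..n} \<in> {I. int_interval I \<and> n \<in> I}" by (force simp: int_interval_def)
  then show "{I. int_interval I \<and> n \<in> I} \<noteq> {}" by blast
next
  fix I assume "I \<in> {I. int_interval I \<and> n \<in> I}"
  then obtain a b where "I = {a..b}" "n \<in> {a..b}" by (auto simp: int_interval_def)
  then show "(\<Sum>i\<in>I. \<bar>indicator S i :: real\<bar>) / real (card I) \<le> B"
    using assms by (simp only: average_indicator finite_atLeastAtMost_int)
qed

lemma maximal_fun_witness_set:
  assumes "-1 \<le> n" "n \<le> 3 * int m - 2"
  shows "maximal_fun (indicator (witness_set m)) n = 1 / 2 + 1 / 2 * chi3 n"
proof (cases "3 dvd n")
  case True
  then have "witness_set m \<inter> {n..n} = {n}"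
    using assms by (auto simp: witness_set_iff_dvd)
  then have "1 \<le> maximal_fun (indicator (witness_set m)) n"
    using average_indicator_le_maximal_fun[of n n n "witness_set m"] by simp
  moreover have "maximal_fun (indicator (witness_set m)) n \<le> 1"
  proof (rule maximal_fun_indicator_le)
    fix a b :: int
    have "card (witness_set m \<inter> {a..b}) \<le> card {a..b}" by (rule card_mono) auto
    then show "real (card (witness_set m \<inter> {a..b})) / real (card {a..b}) \<le> 1"
      unfolding divide_le_eq_1 by linarith
  qed
  ultimately show ?thesis using True by simp
next
  case False
  have "1 / 2 \<le> maximal_fun (indicator (witness_set m)) n"
  \<comment> \<open>A non-multiple of 3 is adjacent to exactly one multiple, on the left for residue
    1 and on the right for residue 2. The range of \<open>n\<close> is chosen so that this neighbour
    belongs to the witness set; the pair has average 1/2.\<close>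
  proof (cases "n mod 3 = 1")
    case True
    then have "3 dvd n - 1" by presburger
    moreover have "{n - 1..n} = {n - 1, n}" by auto
    ultimately have "witness_set m \<inter> {n - 1..n} = {n - 1}"
      using assms False by (simp add: witness_set_iff_dvd)
    then show ?thesis
      using average_indicator_le_maximal_fun[of n "n - 1" n "witness_set m"] by simp
  next
    case n2: False
    then have "3 dvd n + 1" using False by presburger
    moreover have "{n..n + 1} = {n, n + 1}" by auto
    ultimately have "witness_set m \<inter> {n..n + 1} = {n + 1}"
      using assms False by (simp add: witness_set_iff_dvd)
    then show ?thesis
      using average_indicator_le_maximal_fun[of n n "n + 1" "witness_set m"] by simp
  qed
  moreover have "maximal_fun (indicator (witness_set m)) n \<le> 1 / 2"
  proof (rule maximal_fun_indicator_le)
    fix a b assume ab: "n \<in> {a..b}"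
    have le: "card (witness_set m \<inter> {a..b}) \<le> nat (b div 3 - (a + 2) div 3 + 1)"
      unfolding card_multiples_of_3[symmetric]
      by (rule card_mono[OF finite_subset[of _ "{a..b}"]]) (auto simp: witness_set_iff)
    have "a \<le> n" "n \<le> b" using ab by auto
    \<comment> \<open>An interval with c > 0 multiples of 3 has at least 3c - 2 points, and 3c - 2
      >= 2c once c >= 2. For c = 1 the non-multiple \<open>n\<close> supplies the second
      point.\<close>
    then have "2 * (b div 3 - (a + 2) div 3 + 1) \<le> b - a + 1" "a \<le> b"
      using False by presburger+
    then have "2 * int (nat (b div 3 - (a + 2) div 3 + 1)) \<le> b - a + 1"
      by (cases "0 \<le> b div 3 - (a + 2) div 3 + 1") auto
    also have "b - a + 1 = int (card {a..b})" using ab by simp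
    finally have "2 * nat (b div 3 - (a + 2) div 3 + 1) \<le> card {a..b}" by linarith
    then have "2 * card (witness_set m \<inter> {a..b}) \<le> card {a..b}" using le by linarith
    then have "2 * real (card (witness_set m \<inter> {a..b})) \<le> real (card {a..b})" by linarith
    then show "real (card (witness_set m \<inter> {a..b})) / real (card {a..b}) \<le> 1 / 2"
      using ab by (simp add: divide_le_eq)
  qed
  ultimately show ?thesis using False by simp
qed

section \<open>Comparison with the model on the bulk\<close>

text \<open>The derivative at \<open>n\<close> reads values on \<open>{n..n + int k}\<close> only.
  Lowering the upper end by \<open>k\<close> keeps this window inside
  \<open>{-1..3 * int m - 2}\<close>, where the formula for the maximal function is valid
  too.\<close>

lemma discrete_deriv_witness_set_bulk:
  assumes "n \<in> {-1..3 * int m - 2 - int k}"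
  shows "discrete_deriv k (indicator (witness_set m)) n = discrete_deriv k chi3 n"
  by (rule discrete_deriv_cong)
    (use assms in \<open>auto simp: indicator_def witness_set_iff_dvd\<close>)

text \<open>For \<open>k > 0\<close> equality holds. For \<open>k = 0\<close> the additional 1/2 is
  added to a nonnegative value, so it can only help.\<close>

lemma discrete_deriv_maximal_fun_bulk:
  assumes "n \<in> {-1..3 * int m - 2 - int k}"
  shows "1 / 2 * \<bar>discrete_deriv k chi3 n\<bar>
    \<le> \<bar>discrete_deriv k (maximal_fun (indicator (witness_set m))) n\<bar>"
proof -
  have "discrete_deriv k (maximal_fun (indicator (witness_set m))) n
      = discrete_deriv k (\<lambda>i. 1 / 2 + 1 / 2 * chi3 i) n"
    by (rule discrete_deriv_cong, rule maximal_fun_witness_set) (use assms in auto)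
  then show ?thesis
    unfolding discrete_deriv_affine by (cases "k = 0") auto
qed

text \<open>This is the contribution common to numerator and denominator, before taking the root of
  order \<open>q\<close>.\<close>

definition bulk_sum :: "nat \<Rightarrow> real \<Rightarrow> nat \<Rightarrow> real" where
  "bulk_sum k q m = (\<Sum>n\<in>{-1..3 * int m - 2 - int k}. \<bar>discrete_deriv k chi3 n\<bar> powr q)"

lemma bulk_sum_nonneg: "0 \<le> bulk_sum k q m"
  unfolding bulk_sum_def by (intro sum_nonneg) auto

text \<open>By periodicity a nonzero value of the derivative recurs at every third point, so the sum
  grows at least linearly in \<open>m\<close>.\<close>

lemma bulk_sum_at_top: "filterlim (bulk_sum k q) at_top sequentially"
proof -
  let ?D = "discrete_deriv k chi3"
  have per: "?D (n + 3) = ?D n" for n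
    by (rule discrete_deriv_periodic) (rule chi3_periodic)
  obtain n1 where n1: "?D n1 \<noteq> 0" using discrete_deriv_chi3_nonzero by blast
  define r where "r = n1 mod 3"
  have r: "0 \<le> r" "r \<le> 2" by (simp_all add: r_def)
  have shift: "?D (n + int j * 3) = ?D n" for n j
    by (rule add_period_mult) (rule per)
  obtain d where n1_eq: "n1 = r + d * 3"
    unfolding r_def by (metis add.commute div_mult_mod_eq)
  have "?D r = ?D n1"
  proof (cases d rule: int_cases2)
    case (nonneg j)
    then show ?thesis using n1_eq shift[of r j] by simp
  next
    case (nonpos j)
    then have "r = n1 + int j * 3" using n1_eq by linarith
    then show ?thesis using shift[of n1 j] by simp
  qed
  then have pos: "0 < \<bar>?D r\<bar> powr q" using n1 by simp
  have "real (m - (k + 1)) * \<bar>?D r\<bar> powr q \<le> bulk_sum k q m" for m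
  proof -
    \<comment> \<open>Since \<open>r \<le> 2\<close>, these points are at most 3m - 3k - 4 and so
      stay in the bulk; for \<open>m \<le> k + 1\<close> there are none.\<close>
    let ?J = "(\<lambda>j. r + int j * 3) ` {..<m - (k + 1)}"
    have "inj_on (\<lambda>j. r + int j * 3) {..<m - (k + 1)}" by (auto simp: inj_on_def)
    then have "(\<Sum>n\<in>?J. \<bar>?D n\<bar> powr q) = real (m - (k + 1)) * \<bar>?D r\<bar> powr q"
      by (simp add: sum.reindex shift)
    moreover have "(\<Sum>n\<in>?J. \<bar>?D n\<bar> powr q) \<le> bulk_sum k q m"
      unfolding bulk_sum_def by (rule sum_mono2) (use r in auto)
    ultimately show ?thesis by simp
  qed
  then have "\<forall>\<^sub>F m in sequentially. real (m - (k + 1)) * \<bar>?D r\<bar> powr q \<le> bulk_sum k q m"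
    by (rule always_eventually[OF allI])
  moreover have "filterlim (\<lambda>m. m - (k + 1)) at_top sequentially"
    by (rule filterlim_minus_const_nat_at_top)
  then have "filterlim (\<lambda>m. real (m - (k + 1))) at_top sequentially"
    by (rule filterlim_compose[OF filterlim_real_sequentially])
  then have "filterlim (\<lambda>m. real (m - (k + 1)) * \<bar>?D r\<bar> powr q) at_top sequentially"
    by (rule filterlim_at_top_mult_tendsto_pos[OF tendsto_const pos])
  ultimately show ?thesis
    by (rule filterlim_at_top_mono[rotated])
qed

section \<open>Bounds for the two norms\<close>

lemma lp_norm_deriv_maximal_fun_ge:
  assumes "1 \<le> p" "p < \<infinity>"
  defines "q \<equiv> enn2real p"
  shows "ennreal (1 / 2 * bulk_sum k q m powr (1 / q))
    \<le> lp_norm p (discrete_deriv k (maximal_fun (indicator (witness_set m))))"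
proof -
  let ?M = "discrete_deriv k (maximal_fun (indicator (witness_set m)))"
  let ?I = "{-1..3 * int m - 2 - int k}"
  have q: "1 \<le> q"
    unfolding q_def by (rule one_le_enn2real) (use assms in auto)
  have "(1 / 2) powr q * bulk_sum k q m \<le> (\<Sum>n\<in>?I. \<bar>?M n\<bar> powr q)"
    unfolding bulk_sum_def sum_distrib_left
  proof (rule sum_mono)
    fix n assume "n \<in> ?I"
    then have "(1 / 2 * \<bar>discrete_deriv k chi3 n\<bar>) powr q \<le> \<bar>?M n\<bar> powr q"
      using q by (intro powr_mono2 discrete_deriv_maximal_fun_bulk) auto
    then show "(1 / 2) powr q * \<bar>discrete_deriv k chi3 n\<bar> powr q \<le> \<bar>?M n\<bar> powr q"
      by (simp only: powr_mult)
  qed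
  then have "((1 / 2) powr q * bulk_sum k q m) powr (1 / q)
      \<le> (\<Sum>n\<in>?I. \<bar>?M n\<bar> powr q) powr (1 / q)"
    using q by (intro powr_mono2) (auto simp: bulk_sum_nonneg)
  moreover have "((1 / 2) powr q * bulk_sum k q m) powr (1 / q)
      = 1 / 2 * bulk_sum k q m powr (1 / q)"
    unfolding powr_mult powr_powr using q by simp
  ultimately have "1 / 2 * bulk_sum k q m powr (1 / q) \<le> (\<Sum>n\<in>?I. \<bar>?M n\<bar> powr q) powr (1 / q)"
    by linarith
  then have "ennreal (1 / 2 * bulk_sum k q m powr (1 / q))
      \<le> ennreal ((\<Sum>n\<in>?I. \<bar>?M n\<bar> powr q) powr (1 / q))"
    by (rule ennreal_leI)
  also have "\<dots> \<le> lp_norm p ?M"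
    unfolding q_def by (rule lp_norm_ge_finite[OF assms(2,1)]) simp
  finally show ?thesis .
qed

text \<open>Outside the bulk the derivative is supported on at most 2k + 2 points, and there it is
  at most \<open>2 ^ k\<close> in absolute value. This error does not depend on
  \<open>m\<close>.\<close>

lemma lp_norm_deriv_witness_set:
  assumes "1 \<le> p" "p < \<infinity>"
  defines "q \<equiv> enn2real p"
  obtains B where "lp_norm p (discrete_deriv k (indicator (witness_set m))) = ennreal (B powr (1 / q))"
    and "bulk_sum k q m \<le> B" and "B \<le> bulk_sum k q m + (2 * real k + 2) * (2 ^ k) powr q"
proof -
  let ?D = "discrete_deriv k (indicator (witness_set m))"
  let ?I = "{-1..3 * int m - 2 - int k}"
  \<comment> \<open>The first interval contains the support of the derivative. The union is there
    for \<open>k = 0\<close>, where the bulk may contain the point -1 outside of it.\<close>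
  let ?F = "{- int k..3 * int m} \<union> ?I"
  let ?B = "\<Sum>n\<in>?F. \<bar>?D n\<bar> powr q"
  have "1 \<le> q"
    unfolding q_def by (rule one_le_enn2real) (use assms in auto)
  have "?D n = 0" if "n \<notin> ?F" for n
  proof -
    \<comment> \<open>The zero function is written in affine form so that
      \<open>discrete_deriv_affine\<close> evaluates its derivative.\<close>
    have "?D n = discrete_deriv k (\<lambda>i. 0 + 0 * chi3 i) n"
      by (rule discrete_deriv_cong) (use that in \<open>auto simp: indicator_def witness_set_iff\<close>)
    then show ?thesis unfolding discrete_deriv_affine by simp
  qed
  then have norm: "lp_norm p ?D = ennreal (?B powr (1 / q))"
    unfolding q_def by (intro lp_norm_eq_finite assms) auto
  have B: "?B = bulk_sum k q m + (\<Sum>n\<in>?F - ?I. \<bar>?D n\<bar> powr q)"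
  proof -
    have "?B = (\<Sum>n\<in>?I. \<bar>?D n\<bar> powr q) + (\<Sum>n\<in>?F - ?I. \<bar>?D n\<bar> powr q)"
      by (subst add.commute, rule sum.subset_diff) auto
    also have "(\<Sum>n\<in>?I. \<bar>?D n\<bar> powr q) = bulk_sum k q m"
      unfolding bulk_sum_def by (simp add: discrete_deriv_witness_set_bulk)
    finally show ?thesis .
  qed
  have "0 \<le> (\<Sum>n\<in>?F - ?I. \<bar>?D n\<bar> powr q)" by (intro sum_nonneg) auto
  moreover have "(\<Sum>n\<in>?F - ?I. \<bar>?D n\<bar> powr q) \<le> (2 * real k + 2) * (2 ^ k) powr q"
  proof -
    have "\<bar>?D n\<bar> \<le> 2 ^ k" for n
      using abs_discrete_deriv_le[of "indicator (witness_set m)" 1 k n] by (simp add: indicator_def)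
    then have "(\<Sum>n\<in>?F - ?I. \<bar>?D n\<bar> powr q) \<le> real (card (?F - ?I)) * (2 ^ k) powr q"
      using \<open>1 \<le> q\<close> by (intro sum_bounded_above powr_mono2) auto
    moreover have "card (?F - ?I) \<le> 2 * k + 2"
    proof -
      have "card (?F - ?I) \<le> card ({- int k..-2} \<union> {3 * int m - 1 - int k..3 * int m})"
        by (rule card_mono) auto
      also have "\<dots> \<le> card {- int k..-2} + card {3 * int m - 1 - int k..3 * int m}"
        by (rule card_Un_le)
      also have "\<dots> \<le> 2 * k + 2" by simp
      finally show ?thesis .
    qed
    then have "real (card (?F - ?I)) \<le> 2 * real k + 2" by linarith
    then have "real (card (?F - ?I)) * (2 ^ k) powr q \<le> (2 * real k + 2) * (2 ^ k) powr q"
      by (rule mult_right_mono) simp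
    ultimately show ?thesis by linarith
  qed
  ultimately show thesis
    by (intro that[OF norm]; unfold B; linarith)
qed

section \<open>Limit of the ratio and the bound for the constant\<close>

theorem theorem2p7:
  fixes k :: nat and p :: ennreal
  assumes "1 \<le> p" and "p < \<infinity>"
  shows "best_const k p \<ge> 1 / 2 \<and>
    liminf (\<lambda>m. lp_norm p (discrete_deriv k (maximal_fun (indicator (witness_set m))))
               / lp_norm p (discrete_deriv k (indicator (witness_set m)))) \<ge> 1 / 2"
proof -
  define q where "q = enn2real p"
  define K where "K = (2 * real k + 2) * (2 ^ k) powr q"
  let ?A = "bulk_sum k q"
  let ?num = "\<lambda>m. lp_norm p (discrete_deriv k (maximal_fun (indicator (witness_set m))))"
  let ?den = "\<lambda>m. lp_norm p (discrete_deriv k (indicator (witness_set m)))"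
  \<comment> \<open>With A the bulk sum, the ratio is at least half of (A / (A + K))^(1/q) when A >
    0. The quotient is written as 1 - K / (A + K), whose limit is visible from A tending to
    infinity.\<close>
  let ?h = "\<lambda>m. 1 / 2 * (1 - K / (?A m + K)) powr (1 / q)"
  have q: "1 \<le> q"
    unfolding q_def by (rule one_le_enn2real) (use assms in auto)
  have K: "0 \<le> K" by (simp add: K_def)
  have "filterlim (\<lambda>m. ?A m + K) at_top sequentially"
    by (subst add.commute) (intro filterlim_tendsto_add_at_top[OF tendsto_const] bulk_sum_at_top)
  then have "((\<lambda>m. K / (?A m + K)) \<longlongrightarrow> 0) sequentially"
    by (intro real_tendsto_divide_at_top[OF tendsto_const])
  then have "(?h \<longlongrightarrow> 1 / 2 * (1 - 0) powr (1 / q)) sequentially"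
    using q by (intro tendsto_intros) auto
  then have "((\<lambda>m. ennreal (?h m)) \<longlongrightarrow> ennreal (1 / 2)) sequentially"
    by (intro tendsto_ennrealI) simp
  then have lim: "liminf (\<lambda>m. ennreal (?h m)) = 1 / 2"
    by (subst lim_imp_Liminf) (auto simp: divide_ennreal[of 1 2, simplified, symmetric] ennreal_divide_numeral)

  have pos: "\<forall>\<^sub>F m in sequentially. 0 < ?A m"
    using bulk_sum_at_top[of k q] by (simp add: filterlim_at_top_dense)
  \<comment> \<open>A positive bulk sum forces a nonzero denominator, so the quotient in
    \<open>ennreal\<close> is genuine and the denominator may be cancelled later.\<close>
  have bounds: "?den m \<noteq> 0 \<and> ?den m < \<infinity> \<and> ennreal (?h m) \<le> ?num m / ?den m"
    if A: "0 < ?A m" for m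
  proof -
    obtain B where B: "?den m = ennreal (B powr (1 / q))" "?A m \<le> B" "B \<le> ?A m + K"
      unfolding q_def K_def by (rule lp_norm_deriv_witness_set[OF assms])
    have "0 < B" using A B by linarith
    have "1 - K / (?A m + K) = ?A m / (?A m + K)" using A K by (simp add: field_simps)
    also have "\<dots> \<le> ?A m / B" using A B K \<open>0 < B\<close> by (intro divide_left_mono) auto
    finally have "(1 - K / (?A m + K)) powr (1 / q) \<le> (?A m / B) powr (1 / q)"
      using A K q by (intro powr_mono2) auto
    then have "?h m \<le> (1 / 2 * ?A m powr (1 / q)) / B powr (1 / q)"
      using A \<open>0 < B\<close> by (simp add: powr_divide)
    then have "ennreal (?h m) \<le> ennreal (1 / 2 * ?A m powr (1 / q)) / ?den m"
      using \<open>0 < B\<close> unfolding B(1) by (subst divide_ennreal) (auto intro: ennreal_leI)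
    also have "\<dots> \<le> ?num m / ?den m"
      unfolding q_def by (intro divide_right_mono_ennreal lp_norm_deriv_maximal_fun_ge assms)
    finally show ?thesis using B \<open>0 < B\<close> by simp
  qed

  have "liminf (\<lambda>m. ennreal (?h m)) \<le> liminf (\<lambda>m. ?num m / ?den m)"
    by (rule Liminf_mono, rule eventually_mono[OF pos]) (use bounds in blast)
  then have main: "1 / 2 \<le> liminf (\<lambda>m. ?num m / ?den m)" by (simp only: lim)

  \<comment> \<open>Any admissible \<open>C\<close> bounds the ratio for all large \<open>m\<close>,
    hence also its lower limit.\<close>
  have "1 / 2 \<le> C"
    if C: "\<forall>S :: int set. lp_norm p (discrete_deriv k (indicator S)) < \<infinity> \<longrightarrow>
       lp_norm p (discrete_deriv k (maximal_fun (indicator S)))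
         \<le> C * lp_norm p (discrete_deriv k (indicator S))" for C
  proof -
    have "?num m / ?den m \<le> C" if "0 < ?A m" for m
    proof -
      have "?num m / ?den m \<le> (C * ?den m) / ?den m"
        using C bounds[OF that] by (intro divide_right_mono_ennreal) auto
      also have "\<dots> = C"
        using bounds[OF that] ennreal_mult_divide_eq[of "?den m" C] by (auto simp: less_top)
      finally show ?thesis .
    qed
    then have "liminf (\<lambda>m. ?num m / ?den m) \<le> liminf (\<lambda>m. C)"
      by (intro Liminf_mono eventually_mono[OF pos])
    then show ?thesis using main by (simp add: Liminf_const)
  qed
  then have "1 / 2 \<le> best_const k p"
    unfolding best_const_def by (intro Inf_greatest) auto
  with main show ?thesis by blast
qed

end
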